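(* Let $b^{\ast}>0$, let $I\subset[0,b^{\ast}]$ be an interval with interior $I^{\circ}$, and let $f:I\to\mathbb{R}$ be a twice differentiable mapping on $I^{\circ}$ such that $f''\in L[a,b]$, where $a,b\in I$ with $a<b$. If $|f''|^{q}$ is $(\alpha,m)$-convex on $[a,b]$ for $(\alpha,m)\in[0,1]^2$, $q\ge 1$, then the following inequality holds: $$\left|\frac{f(a)+f(mb)}{2}-\frac{1}{mb-a}\int_{a}^{mb}f(x)\,dx\right|\le\frac{(mb-a)^2}{2}\left(\frac16\right)^{1-\frac1q}\left[|f''(a)|^{q}\frac{1}{(\alpha+2)(\alpha+3)}+m|f''(b)|^{q}\left(\frac16-\frac{1}{(\alpha+2)(\alpha+3)}\right)\right]^{\frac1q}.$$
   Context: $L[a,b]$ denotes the space of integrable functions on $[a,b]$. For $(\alpha,m)\in[0,1]^2$, a function $g:[0,b]\to\mathbb{R}$ is said to be $(\alpha,m)$-convex if $g(tx+m(1-t)y)\le t^{\alpha}g(x)+m(1-t^{\alpha})g(y)$ for every $x,y\in[0,b]$ and $t\in[0,1]$; "$(\alpha,m)$-convex on $[a,b]$" refers to the same inequality with $x,y\in[a,b]$ and $t\in[0,1]$. *)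

theory Defs
  imports "HOL-Analysis.Analysis"
begin

text \<open>
  The convention is \<open>0\<^sup>0 = 1\<close>, whereas \<open>0 powr 0 = 0\<close>.  It matters for \<open>\<alpha> = 0\<close>, \<open>t = 0\<close>; with it,
  \<open>(0, 0)\<close>-convexity on \<open>[0, b]\<close> means that \<open>g\<close> is nondecreasing.
\<close>
definition rpow :: "real \<Rightarrow> real \<Rightarrow> real" where
  "rpow t \<alpha> = (if \<alpha> = 0 then 1 else t powr \<alpha>)"

text \<open>
  Only \<open>x\<close> and \<open>y\<close> range over \<open>S\<close>: for \<open>S = [a, b]\<close> with \<open>0 \<le> a\<close> and \<open>m \<le> 1\<close> the argument of \<open>g\<close> on
  the left-hand side ranges over \<open>[m a, b]\<close>.
\<close>
definition alpha_m_convex_on :: "real \<Rightarrow> real \<Rightarrow> real set \<Rightarrow> (real \<Rightarrow> real) \<Rightarrow> bool" where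
  "alpha_m_convex_on \<alpha> m S g \<longleftrightarrow>
     (\<forall>x\<in>S. \<forall>y\<in>S. \<forall>t\<in>{0..1}.
        g (t * x + m * (1 - t) * y) \<le> rpow t \<alpha> * g x + m * (1 - rpow t \<alpha>) * g y)"

end

theory Submission
  imports Defs
begin

text \<open>
  Let \<open>v = m b\<close>.  The trapezoidal error over the segment from \<open>a\<close> to \<open>v\<close> is
  \<open>(v - a)\<^sup>2 / 2\<close> times the integral of \<open>t (1 - t) f'' (t a + (1 - t) v)\<close> over \<open>[0, 1]\<close>: two
  integrations by parts, done at once in \<open>trapezoid_error_has_integral\<close>.  The arguments of
  \<open>f''\<close> in this integral are those on the left-hand side of the convexity inequality for
  \<open>x = a\<close> and \<open>y = b\<close>, so \<open>|f''|\<^sup>q\<close> is at most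
  \<open>t\<^sup>\<alpha> |f'' a|\<^sup>q + m (1 - t\<^sup>\<alpha>) |f'' b|\<^sup>q\<close> there.  The power-mean inequality with weight
  \<open>t (1 - t)\<close> (\<open>weighted_power_mean_bound\<close>) turns this pointwise bound on the \<open>q\<close>-th power into a
  bound on the integral, and the moments of the weight are
  \<open>\<integral> t (1 - t) t\<^sup>\<alpha> = 1 / ((\<alpha> + 2) (\<alpha> + 3))\<close>, which for \<open>\<alpha> = 0\<close> is \<open>1 / 6\<close>.

  When \<open>m b < a\<close>, the segment lies outside \<open>[a, b]\<close> except for its end point.  The gauge integral
  covers this case as well: it integrates every derivative, so the identity follows from the
  differentiability of \<open>f\<close> and \<open>f'\<close> on the segment.  With the signed length \<open>v - a\<close> and the signed
  integral of \<open>f\<close>, the same formulas serve both orders of \<open>a\<close> and \<open>m b\<close>.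
\<close>

text \<open>
  This is Hoelder's inequality for the measure with density \<open>w\<close>, with the bound \<open>B\<close> in place of
  \<open>|g|\<^sup>q\<close>, so that no integral of \<open>|g|\<^sup>q\<close> has to be formed.  The reason is Young's inequality
  \<open>y M\<^sup>1\<^sup>-\<^sup>1\<^sup>/\<^sup>q \<le> y\<^sup>q / q + (1 - 1 / q) M\<close> with a constant \<open>M\<close>: it is linear in \<open>y\<^sup>q\<close>, so \<open>B\<close> can be
  inserted pointwise, before integrating.  The optimal \<open>M\<close> is the weighted mean \<open>K / W\<close>.
\<close>
lemma weighted_power_mean_bound:
  fixes w g B :: "'n::euclidean_space \<Rightarrow> real"
  assumes q: "q \<ge> 1" and W: "W > 0"
    and w: "\<And>x. x \<in> S \<Longrightarrow> w x \<ge> 0"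
    and gB: "\<And>x. x \<in> S \<Longrightarrow> \<bar>g x\<bar> powr q \<le> B x"
    and iw: "(w has_integral W) S"
    and ig: "((\<lambda>x. w x * g x) has_integral J) S"
    and iB: "((\<lambda>x. w x * B x) has_integral K) S"
  shows "\<bar>J\<bar> \<le> W powr (1 - 1 / q) * K powr (1 / q)"
proof -
  define s where "s = 1 / q"
  have s: "0 < s" "s \<le> 1" using q by (auto simp: s_def)
  have B0: "B x \<ge> 0" if "x \<in> S" for x
    using gB[OF that] powr_ge_zero[of "\<bar>g x\<bar>" q] by linarith
  have K0: "K \<ge> 0"
    by (rule has_integral_nonneg[OF iB]) (simp add: w B0)
  have young: "\<bar>J\<bar> * M powr (1 - s) \<le> s * K + (1 - s) * M * W" if M: "M > 0" for M
  proof -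
    have pw: "\<bar>g x\<bar> * M powr (1 - s) \<le> s * B x + (1 - s) * M" if x: "x \<in> S" for x
    proof (cases "g x = 0")
      case True
      then show ?thesis using s M B0[OF x] by simp
    next
      case False
      have "\<bar>g x\<bar> = (\<bar>g x\<bar> powr q) powr s"
        using q by (simp add: powr_powr s_def)
      then have "\<bar>g x\<bar> * M powr (1 - s) = (\<bar>g x\<bar> powr q) powr s * M powr (1 - s)"
        by simp
      also have "\<dots> \<le> s * (\<bar>g x\<bar> powr q) + (1 - s) * M"
        using s M False by (intro Youngs_inequality_0) auto
      also have "\<dots> \<le> s * B x + (1 - s) * M"
        using gB[OF x] s by simp
      finally show ?thesis .
    qed
    have i1: "((\<lambda>x. w x * g x * M powr (1 - s)) has_integral J * M powr (1 - s)) S"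
      by (rule has_integral_mult_left[OF ig])
    have i2: "((\<lambda>x. s * (w x * B x) + ((1 - s) * M) * w x) has_integral
        s * K + ((1 - s) * M) * W) S"
      by (intro has_integral_add has_integral_mult_right iB iw)
    have le: "norm (w x * g x * M powr (1 - s)) \<le> s * (w x * B x) + ((1 - s) * M) * w x"
      if x: "x \<in> S" for x
      using mult_left_mono[OF pw[OF x] w[OF x]] w[OF x]
      by (simp add: abs_mult algebra_simps)
    have "norm (integral S (\<lambda>x. w x * g x * M powr (1 - s)))
        \<le> integral S (\<lambda>x. s * (w x * B x) + ((1 - s) * M) * w x)"
      using i1 i2 le by (intro integral_norm_bound_integral) (auto simp: has_integral_iff)
    then show ?thesis
      unfolding integral_unique[OF i1] integral_unique[OF i2] by (simp add: abs_mult)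
  qed
  show ?thesis
  proof (cases "K = 0")
    case True
    \<comment> \<open>The optimal \<open>M\<close> would be \<open>0\<close>; the estimate is exploited for \<open>M = \<epsilon>\<^sup>q\<close> with \<open>\<epsilon>\<close> tending to \<open>0\<close>.\<close>
    have small: "\<bar>J\<bar> \<le> W * e" if e: "e > 0" for e
    proof -
      define M where "M = e powr q"
      have M: "M > 0" using e by (simp add: M_def)
      have "M powr s = e" using e q by (simp add: M_def s_def powr_powr)
      moreover have "M powr s * M powr (1 - s) = M" using M by (simp flip: powr_add)
      ultimately have eM: "e * M powr (1 - s) = M" by simp
      have "(1 - s) * M * W \<le> 1 * M * W"
        using s M W by (intro mult_right_mono) auto
      then have "\<bar>J\<bar> * M powr (1 - s) \<le> W * e * M powr (1 - s)"
        using young[OF M] True eM by (simp add: mult.assoc mult.commute)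
      then show ?thesis using M by simp
    qed
    have "\<bar>J\<bar> \<le> 0 + d" if "d > 0" for d
      using small[of "d / W"] that W by simp
    then have "\<bar>J\<bar> \<le> 0" by (rule field_le_epsilon)
    then show ?thesis by simp
  next
    case False
    with K0 have K: "K > 0" by simp
    have KW: "K / W > 0" using K W by simp
    have "s * K + (1 - s) * (K / W) * W = K"
      using W by (simp add: algebra_simps diff_divide_distrib)
    with young[OF KW] have "\<bar>J\<bar> * (K / W) powr (1 - s) \<le> K"
      by simp
    then have "\<bar>J\<bar> \<le> K / (K / W) powr (1 - s)"
      using K W by (simp add: pos_le_divide_eq)
    also have "\<dots> = W powr (1 - s) * (K / K powr (1 - s))"
      using K W by (simp add: powr_divide)
    also have "K / K powr (1 - s) = K powr s"
      using K powr_diff[of K 1 "1 - s"] by simp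
    finally show ?thesis by (simp add: s_def)
  qed
qed

text \<open>
  With \<open>P t = t u + (1 - t) v\<close> and an antiderivative \<open>F\<close> of \<open>f\<close>, the function
  \<open>G t = t (1 - t) f' (P t) (u - v) - (1 - 2 t) f (P t) - 2 F (P t) / (u - v)\<close> has the derivative
  \<open>t (1 - t) (u - v)\<^sup>2 f'' (P t)\<close>: the terms in \<open>f'\<close> and \<open>f\<close> cancel.  The fundamental theorem for
  gauge integrals gives both the existence of the integral and its value \<open>G 1 - G 0\<close>, up to the
  factor \<open>(u - v)\<^sup>2\<close>.
\<close>
lemma trapezoid_error_has_integral:
  fixes f f' f'' :: "real \<Rightarrow> real" and u v :: real
  assumes uv: "u \<noteq> v"
    and f: "\<And>x. x \<in> closed_segment u v \<Longrightarrow>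
      (f has_real_derivative f' x) (at x within closed_segment u v)"
    and f': "\<And>x. x \<in> closed_segment u v \<Longrightarrow>
      (f' has_real_derivative f'' x) (at x within closed_segment u v)"
  shows "((\<lambda>t. t * (1 - t) * f'' (t * u + (1 - t) * v)) has_integral
    2 / (v - u)\<^sup>2 * ((f u + f v) / 2 - 1 / (v - u) * (LBINT x=u..v. f x))) {0..1}"
proof -
  let ?S = "closed_segment u v"
  have S: "?S = {min u v..max u v}"
    by (auto simp: closed_segment_eq_real_ivl)
  have cont: "continuous_on {min u v..max u v} f"
    unfolding S[symmetric] by (rule DERIV_continuous_on[OF f])
  obtain F where F: "\<And>x. x \<in> {min u v..max u v} \<Longrightarrow>
      (F has_vector_derivative f x) (at x within {min u v..max u v})"
    using antiderivative_continuous[OF cont] by blast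
  have LB: "(LBINT x=u..v. f x) = F v - F u"
    by (rule interval_integral_FTC_finite[OF cont]) (use F in auto)
  have Fd: "(F has_real_derivative f x) (at x within ?S)" if "x \<in> ?S" for x
    using F that by (simp add: S has_real_derivative_iff_has_vector_derivative)
  define P where "P t = t * u + (1 - t) * v" for t
  have PS: "P ` {0..1} \<subseteq> ?S"
  proof (rule image_subsetI)
    fix t :: real assume "t \<in> {0..1}"
    then show "P t \<in> ?S"
      unfolding P_def in_segment by (intro exI[of _ "1 - t"]) simp
  qed
  have dP: "(P has_real_derivative (u - v)) (at t within {0..1})" for t
    unfolding P_def by (auto intro!: derivative_eq_intros)
  have chain: "((\<lambda>t. h (P t)) has_real_derivative h' (P t) * (u - v)) (at t within {0..1})"
    if h: "\<And>x. x \<in> ?S \<Longrightarrow> (h has_real_derivative h' x) (at x within ?S)"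
      and t: "t \<in> {0..1}" for h h' t
  proof -
    have "(h has_real_derivative h' (P t)) (at (P t) within P ` {0..1})"
      using h[of "P t"] PS t by (blast intro: DERIV_subset)
    from DERIV_image_chain[OF this dP] show ?thesis by (simp add: o_def)
  qed
  define G where
    "G t = t * (1 - t) * (f' (P t) * (u - v)) - (1 - 2 * t) * f (P t) - 2 / (u - v) * F (P t)" for t
  have dG: "(G has_real_derivative (u - v)\<^sup>2 * (t * (1 - t) * f'' (P t))) (at t within {0..1})"
    if t: "t \<in> {0..1}" for t
  proof -
    note [derivative_intros] = chain[OF f t] chain[OF f' t] chain[OF Fd t]
    show ?thesis
      unfolding G_def using uv
      by (auto intro!: derivative_eq_intros simp: power2_eq_square)
  qed
  have "((\<lambda>t. (u - v)\<^sup>2 * (t * (1 - t) * f'' (P t))) has_integral G 1 - G 0) {0..1}"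
    by (rule fundamental_theorem_of_calculus)
      (auto simp: dG simp flip: has_real_derivative_iff_has_vector_derivative)
  from has_integral_mult_right[OF this, of "1 / (u - v)\<^sup>2"]
  have "((\<lambda>t. t * (1 - t) * f'' (P t)) has_integral 1 / (u - v)\<^sup>2 * (G 1 - G 0)) {0..1}"
    using uv by simp
  moreover have "G 1 - G 0 = 2 * ((f u + f v) / 2 - 1 / (v - u) * (LBINT x=u..v. f x))"
    unfolding LB G_def P_def using uv by (simp add: divide_simps) (simp add: algebra_simps)
  ultimately show ?thesis
    by (simp add: P_def power2_commute[of u v])
qed

text \<open>
  The convention \<open>rpow 0 0 = 1\<close> does no harm: the factor \<open>t\<close> makes the integrand
  \<open>t\<^sup>\<alpha>\<^sup>+\<^sup>1 - t\<^sup>\<alpha>\<^sup>+\<^sup>2\<close> at \<open>t = 0\<close> as well.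
\<close>
lemma has_integral_parabola_rpow:
  assumes "\<alpha> \<ge> 0"
  shows "((\<lambda>t. t * (1 - t) * rpow t \<alpha>) has_integral 1 / ((\<alpha> + 2) * (\<alpha> + 3))) {0..1}"
proof -
  have "((\<lambda>t. t powr (\<alpha> + 1) - t powr (\<alpha> + 2)) has_integral
      1 powr (\<alpha> + 1 + 1) / (\<alpha> + 1 + 1) - 1 powr (\<alpha> + 2 + 1) / (\<alpha> + 2 + 1)) {0..1}"
    using assms by (intro has_integral_diff has_integral_powr_from_0) auto
  moreover have "1 powr (\<alpha> + 1 + 1) / (\<alpha> + 1 + 1) - 1 powr (\<alpha> + 2 + 1) / (\<alpha> + 2 + 1)
      = 1 / ((\<alpha> + 2) * (\<alpha> + 3))"
    using assms by (simp add: divide_simps) (simp add: algebra_simps)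
  moreover have "t powr (\<alpha> + 1) - t powr (\<alpha> + 2) = t * (1 - t) * rpow t \<alpha>"
    if "t \<in> {0..1}" for t
  proof (cases "t = 0")
    case False
    with that have "t powr (\<alpha> + 1) = t * t powr \<alpha>" "t powr (\<alpha> + 2) = t\<^sup>2 * t powr \<alpha>"
      and "rpow t \<alpha> = t powr \<alpha>"
      by (auto simp: powr_add rpow_def)
    then show ?thesis by (simp add: power2_eq_square algebra_simps)
  qed simp
  ultimately show ?thesis
    by (metis (no_types, lifting) has_integral_cong)
qed

theorem theorem3:
  fixes f f' f'' :: "real \<Rightarrow> real" and I :: "real set" and bstar a b \<alpha> m q :: real
  assumes "bstar > 0"
    and "I \<subseteq> {0..bstar}" and "is_interval I"
    and "a \<in> I" and "b \<in> I" and "a < b"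
    and "\<alpha> \<in> {0..1}" and "m \<in> {0..1}" and "q \<ge> 1"
    and "m * b \<in> I" and "m * b \<noteq> a"
    and "\<And>x. x \<in> interior I \<union> (I \<inter> {m * a..b}) \<Longrightarrow>
           (f has_real_derivative f' x) (at x within I)"
    and "\<And>x. x \<in> interior I \<union> (I \<inter> {m * a..b}) \<Longrightarrow>
           (f' has_real_derivative f'' x) (at x within I)"
    and "f'' absolutely_integrable_on {a..b}"
    and "alpha_m_convex_on \<alpha> m {a..b} (\<lambda>x. \<bar>f'' x\<bar> powr q)"
  shows "\<bar>(f a + f (m * b)) / 2 - 1 / (m * b - a) * (LBINT x=a..m * b. f x)\<bar>
    \<le> (m * b - a)\<^sup>2 / 2 * (1 / 6) powr (1 - 1 / q) *
       (\<bar>f'' a\<bar> powr q * (1 / ((\<alpha> + 2) * (\<alpha> + 3)))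
         + m * \<bar>f'' b\<bar> powr q * (1 / 6 - 1 / ((\<alpha> + 2) * (\<alpha> + 3)))) powr (1 / q)"
proof -
  let ?v = "m * b" and ?A = "\<bar>f'' a\<bar> powr q" and ?C = "\<bar>f'' b\<bar> powr q"
  let ?k = "1 / ((\<alpha> + 2) * (\<alpha> + 3))"
  let ?B = "\<lambda>t. rpow t \<alpha> * ?A + m * (1 - rpow t \<alpha>) * ?C"
  let ?E = "(f a + f ?v) / 2 - 1 / (?v - a) * (LBINT x=a..?v. f x)"
  have a0: "0 \<le> a" using assms(2,4) by auto
  have m: "0 \<le> m" "m \<le> 1" and \<alpha>: "\<alpha> \<ge> 0" using assms(7,8) by auto
  have va: "?v \<noteq> a" by (rule assms(11))
  have "m * a \<le> a" "?v \<le> b" "m * a \<le> ?v"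
    using m a0 \<open>a < b\<close> by (auto intro: mult_left_le_one_le mult_left_mono)
  then have seg: "closed_segment a ?v \<subseteq> {m * a..b}"
    using \<open>a < b\<close> by (auto simp: closed_segment_eq_real_ivl)
  have segI: "closed_segment a ?v \<subseteq> I"
    using assms(3,4,10) by (simp add: closed_segment_subset is_interval_convex)
  have ident: "((\<lambda>t. t * (1 - t) * f'' (t * a + (1 - t) * ?v)) has_integral
      2 / (?v - a)\<^sup>2 * ?E) {0..1}"
  proof (rule trapezoid_error_has_integral[OF va[symmetric]])
    fix x assume "x \<in> closed_segment a ?v"
    with seg segI have x: "x \<in> interior I \<union> (I \<inter> {m * a..b})" by blast
    show "(f has_real_derivative f' x) (at x within closed_segment a ?v)"
      by (rule DERIV_subset[OF assms(12)[OF x] segI])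
    show "(f' has_real_derivative f'' x) (at x within closed_segment a ?v)"
      by (rule DERIV_subset[OF assms(13)[OF x] segI])
  qed
  have weight: "((\<lambda>t::real. t * (1 - t)) has_integral 1 / 6) {0..1}"
    using has_integral_parabola_rpow[of 0] by (simp add: rpow_def)
  have conv: "\<bar>f'' (t * a + (1 - t) * ?v)\<bar> powr q \<le> ?B t" if "t \<in> {0..1}" for t
  proof -
    have "\<bar>f'' (t * a + m * (1 - t) * b)\<bar> powr q \<le> ?B t"
      using assms(15) \<open>a < b\<close> that unfolding alpha_m_convex_on_def by auto
    then show ?thesis by (simp add: mult_ac)
  qed
  have "((\<lambda>t. ?A * (t * (1 - t) * rpow t \<alpha>)
        + m * ?C * (t * (1 - t) - t * (1 - t) * rpow t \<alpha>)) has_integral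
      ?A * ?k + m * ?C * (1 / 6 - ?k)) {0..1}"
    by (intro has_integral_add has_integral_mult_right has_integral_diff weight
        has_integral_parabola_rpow \<alpha>)
  then have intB: "((\<lambda>t. t * (1 - t) * ?B t) has_integral
      ?A * ?k + m * ?C * (1 / 6 - ?k)) {0..1}"
    by (rule has_integral_eq[rotated]) (simp add: algebra_simps)
  have bound: "\<bar>2 / (?v - a)\<^sup>2 * ?E\<bar>
      \<le> (1 / 6) powr (1 - 1 / q) * (?A * ?k + m * ?C * (1 / 6 - ?k)) powr (1 / q)"
    using conv by (intro weighted_power_mean_bound[OF assms(9) _ _ _ weight ident intB]) auto
  have "\<bar>?E\<bar> = (?v - a)\<^sup>2 / 2 * \<bar>2 / (?v - a)\<^sup>2 * ?E\<bar>"
    using va by (subst abs_mult) simp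
  also have "\<dots> \<le> (?v - a)\<^sup>2 / 2 * ((1 / 6) powr (1 - 1 / q)
      * (?A * ?k + m * ?C * (1 / 6 - ?k)) powr (1 / q))"
    by (rule mult_left_mono[OF bound]) simp
  finally show ?thesis by (simp only: mult.assoc)
qed

end
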